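(* Let $r$ be a given line. If $\Omega$ is a minor line with respect to $r$ and $\omega$ is a line commensurable with $\Omega$, then $\omega$ is a minor line with respect to $r$.
   Context: Lines (straight-line segments) are represented by positive real numbers, and areas of rectangles by products. Two lines (or two areas) are commensurable if their quotient is a rational number, and incommensurable otherwise. Two lines are incommensurable in square if their squares are incommensurable. Fix a line $r$. A line $a$ is rational (with respect to $r$) if $a^2,r^2$ are commensurable; an area is rational if it is commensurable with $r^2$. A line $m$ is medial if there are rational lines $a,b$, incommensurable with each other, such that $m^2=ab$; an area is medial if it equals $m^2$ for some medial line $m$. A line $\Omega$ is a minor line (with respect to $r$) if there are lines $\Phi>\Psi$ with $\Omega=\Phi-\Psi$ such that $\Phi,\Psi$ are incommensurable in square, $\Phi^2+\Psi^2$ is a rational area, and $\Phi\Psi$ (equivalently $2\Phi\Psi$) is a medial area. *)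

theory Defs
  imports Complex_Main
begin

text \<open>
  Both lines (straight-line segments) and areas of rectangles are represented by
  positive reals. The positivity is carried by the predicates below; the relation
  \<open>commensurable\<close> itself is only meant to be applied to positive arguments.
  The parameter \<open>r\<close> is always the given line with respect to which lines and
  areas are called rational.
\<close>

definition is_line :: "real \<Rightarrow> bool" where
  "is_line a \<longleftrightarrow> 0 < a"

definition is_area :: "real \<Rightarrow> bool" where
  "is_area A \<longleftrightarrow> (\<exists>a b. is_line a \<and> is_line b \<and> A = a * b)"

definition commensurable :: "real \<Rightarrow> real \<Rightarrow> bool" where
  "commensurable x y \<longleftrightarrow> x / y \<in> \<rat>"

abbreviation incommensurable :: "real \<Rightarrow> real \<Rightarrow> bool" where
  "incommensurable x y \<equiv> \<not> commensurable x y"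

definition incommensurable_in_square :: "real \<Rightarrow> real \<Rightarrow> bool" where
  "incommensurable_in_square a b \<longleftrightarrow> incommensurable (a\<^sup>2) (b\<^sup>2)"

definition rational_line :: "real \<Rightarrow> real \<Rightarrow> bool" where
  "rational_line r a \<longleftrightarrow> is_line a \<and> commensurable (a\<^sup>2) (r\<^sup>2)"

definition rational_area :: "real \<Rightarrow> real \<Rightarrow> bool" where
  "rational_area r A \<longleftrightarrow> is_area A \<and> commensurable A (r\<^sup>2)"

definition medial_line :: "real \<Rightarrow> real \<Rightarrow> bool" where
  "medial_line r m \<longleftrightarrow> is_line m \<and>
     (\<exists>a b. rational_line r a \<and> rational_line r b \<and> incommensurable a b \<and> m\<^sup>2 = a * b)"

definition medial_area :: "real \<Rightarrow> real \<Rightarrow> bool" where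
  "medial_area r A \<longleftrightarrow> (\<exists>m. medial_line r m \<and> A = m\<^sup>2)"

definition minor_line :: "real \<Rightarrow> real \<Rightarrow> bool" where
  "minor_line r \<Omega> \<longleftrightarrow>
     (\<exists>\<Phi> \<Psi>. is_line \<Phi> \<and> is_line \<Psi> \<and> \<Phi> > \<Psi> \<and> \<Omega> = \<Phi> - \<Psi> \<and>
        incommensurable_in_square \<Phi> \<Psi> \<and>
        rational_area r (\<Phi>\<^sup>2 + \<Psi>\<^sup>2) \<and>
        medial_area r (\<Phi> * \<Psi>))"

end

theory Submission imports Defs begin

text \<open>
  The quotient \<open>q = \<omega> / \<Omega>\<close> is a positive rational number, and multiplying every line by \<open>q\<close>
  preserves all the notions that make up a minor line: quotients of two lines or of two areas do
  not change, so incommensurability survives, while a comparison with the fixed area \<open>r\<^sup>2\<close>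
  changes only by the rational factor \<open>q\<^sup>2\<close>. Hence if \<open>\<Omega> = \<Phi> - \<Psi>\<close> exhibits \<open>\<Omega>\<close> as a minor
  line, then \<open>\<omega> = q * \<Phi> - q * \<Psi>\<close> exhibits \<open>\<omega>\<close> as one. The only component that hides further
  lines is the medial area; there the scaling has to be pushed down to the rational lines whose
  product it is.
\<close>

lemma commensurable_mult_rat_left:
  assumes "q \<in> \<rat>" and "commensurable x y"
  shows "commensurable (q * x) y"
  using Rats_mult[OF assms(1), of "x / y"] assms(2) by (simp add: commensurable_def)

lemma commensurable_mult_cancel:
  assumes "q \<noteq> 0"
  shows "commensurable (q * x) (q * y) \<longleftrightarrow> commensurable x y"
  using assms by (simp add: commensurable_def)

lemma is_line_mult: "is_line q \<Longrightarrow> is_line a \<Longrightarrow> is_line (q * a)"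
  by (simp add: is_line_def)

lemma rational_line_mult_rat:
  assumes "is_line q" "q \<in> \<rat>" "rational_line r a"
  shows "rational_line r (q * a)"
  using assms by (simp add: rational_line_def is_line_mult power_mult_distrib
      commensurable_mult_rat_left)

lemma rational_area_mult_rat:
  assumes "is_line q" "q \<in> \<rat>" "rational_area r A"
  shows "rational_area r (q * A)"
proof -
  obtain a b where "is_line a" "is_line b" "A = a * b"
    using assms(3) by (auto simp: rational_area_def is_area_def)
  then have "is_line (q * a)" "is_line b" "q * A = (q * a) * b"
    using assms(1) by (auto simp: is_line_mult)
  then have "is_area (q * A)"
    unfolding is_area_def by blast
  then show ?thesis
    using assms by (simp add: rational_area_def commensurable_mult_rat_left)
qed

text \<open>
  If \<open>m\<^sup>2 = a * b\<close>, then \<open>(q * m)\<^sup>2 = (q * a) * (q * b)\<close>: distributing the factor \<open>q\<^sup>2\<close> evenly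
  over both rational lines leaves their quotient, and so their incommensurability, unchanged.
\<close>
lemma medial_line_mult_rat:
  assumes "is_line q" "q \<in> \<rat>" "medial_line r m"
  shows "medial_line r (q * m)"
proof -
  obtain a b where ab: "rational_line r a" "rational_line r b" "incommensurable a b"
      "m\<^sup>2 = a * b" and m: "is_line m"
    using assms(3) by (auto simp: medial_line_def)
  have "rational_line r (q * a)" "rational_line r (q * b)"
    using assms(1,2) ab(1,2) by (auto intro: rational_line_mult_rat)
  moreover have "incommensurable (q * a) (q * b)"
    using ab(3) assms(1) by (simp add: commensurable_mult_cancel is_line_def)
  moreover have "(q * m)\<^sup>2 = (q * a) * (q * b)"
    using ab(4) by (simp add: power_mult_distrib power2_eq_square)
  ultimately show ?thesis
    using m assms(1) unfolding medial_line_def by (blast intro: is_line_mult)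
qed

lemma medial_area_mult_rat_square:
  assumes "is_line q" "q \<in> \<rat>" "medial_area r A"
  shows "medial_area r (q\<^sup>2 * A)"
  using assms medial_line_mult_rat unfolding medial_area_def by (metis power_mult_distrib)

lemma minor_line_mult_rat:
  assumes q: "is_line q" "q \<in> \<rat>" and "minor_line r \<Omega>"
  shows "minor_line r (q * \<Omega>)"
proof -
  obtain \<Phi> \<Psi> where *: "is_line \<Phi>" "is_line \<Psi>" "\<Phi> > \<Psi>" "\<Omega> = \<Phi> - \<Psi>"
      "incommensurable_in_square \<Phi> \<Psi>" "rational_area r (\<Phi>\<^sup>2 + \<Psi>\<^sup>2)" "medial_area r (\<Phi> * \<Psi>)"
    using assms(3) by (auto simp: minor_line_def)
  have "q > 0"
    using q(1) by (simp add: is_line_def)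
  have q2: "is_line (q\<^sup>2)" "q\<^sup>2 \<in> \<rat>"
    using q by (simp_all add: is_line_def)
  have "is_line (q * \<Phi>)" "is_line (q * \<Psi>)"
    using q(1) *(1,2) by (simp_all add: is_line_mult)
  moreover have "q * \<Phi> > q * \<Psi>"
    using *(3) \<open>q > 0\<close> by simp
  moreover have "q * \<Omega> = q * \<Phi> - q * \<Psi>"
    using *(4) by (simp add: right_diff_distrib)
  moreover have "incommensurable_in_square (q * \<Phi>) (q * \<Psi>)"
    using *(5) \<open>q > 0\<close>
    by (simp add: incommensurable_in_square_def power_mult_distrib commensurable_mult_cancel)
  moreover have "rational_area r ((q * \<Phi>)\<^sup>2 + (q * \<Psi>)\<^sup>2)"
    using rational_area_mult_rat[OF q2 *(6)] by (simp add: power_mult_distrib distrib_left)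
  moreover have "medial_area r ((q * \<Phi>) * (q * \<Psi>))"
    using medial_area_mult_rat_square[OF q *(7)] by (simp add: power2_eq_square mult_ac)
  ultimately show ?thesis
    unfolding minor_line_def by blast
qed

theorem propositionX105:
  fixes r \<Omega> \<omega> :: real
  assumes "is_line r"
    and "minor_line r \<Omega>"
    and "is_line \<omega>"
    and "commensurable \<omega> \<Omega>"
  shows "minor_line r \<omega>"
proof -
  have "\<Omega> > 0"
    using assms(2) by (auto simp: minor_line_def)
  then have "is_line (\<omega> / \<Omega>)" "\<omega> / \<Omega> \<in> \<rat>" "\<omega> = \<omega> / \<Omega> * \<Omega>"
    using assms(3,4) by (simp_all add: is_line_def commensurable_def)
  then show ?thesis
    using minor_line_mult_rat[OF _ _ assms(2)] by metis
qed

end
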